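(* Let $d\ge2$ and let $E_1,E_2\subset[1,2]$ be nonempty sets with upper Minkowski dimensions $\beta_1,\beta_2$. Define $$E^*=\left\{\frac{t_1t_2}{\sqrt{t_1^2+t_2^2}}:\ t_1\in E_1,\ t_2\in E_2\right\},\qquad\beta^*=\dim_M(E^* ).$$ Let $1\le p,q\le\infty$ and $r>0$. If $\mathcal{A}^{(2)}_{\hat\sigma_{2d-1},E_1,E_2}:L^p\times L^q\to L^r$ is bounded, then $$\frac1p+\frac1q\le\frac{2d}{d+1}+\frac1r\left(1-\frac{2\beta^*}{d+1}\right).$$
   Context: $\sigma_{2d-1}$ is the normalized spherical measure on the unit sphere $S^{2d-1}\subset\mathbb{R}^{2d}$, and $$\mathcal{A}^{(2)}_{\hat\sigma_{2d-1},E_1,E_2}(f,g)(x)=\sup_{t_1\in E_1,\,t_2\in E_2}\left|\int_{S^{2d-1}}f(x-t_1y)g(x-t_2z)\,d\sigma_{2d-1}(y,z)\right|,\quad x\in\mathbb{R}^d.$$ Boundedness means that the norm of the output in $L^r(\mathbb{R}^d)$ is at most $C\|f\|_{L^p}\|g\|_{L^q}$ with $C$ independent of $f,g$. Upper Minkowski dimension of a bounded set $F\subset\mathbb{R}$: $\dim_M(F)=\limsup_{\delta\to0}\frac{\log N(F,\delta)}{\log(1/\delta)}$, where $N(F,\delta)$ is the minimal number of closed intervals of length $\delta$ needed to cover $F$. *)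

theory Defs
  imports "HOL-Analysis.Analysis"
begin

text \<open>
  The normalized surface measure of the unit sphere, obtained through polar coordinates:
  a Borel set \<open>A\<close> of directions has the measure of the cone
  \<open>{s y | 0 < s < 1, y \<in> A}\<close> divided by the volume of the unit ball.
  It is a measure on the Borel sets of the ambient space which is concentrated on
  \<open>sphere 0 1\<close>; the origin is a null set, so the value of the projection there is irrelevant.
\<close>

definition sphere_measure :: "'a::euclidean_space measure" where
  "sphere_measure = distr (uniform_measure lborel (ball 0 1)) borel (\<lambda>x. x /\<^sub>R norm x)"

lemma emeasure_sphere_measure_UNIV:
  "emeasure (sphere_measure :: 'a::euclidean_space measure) UNIV = 1"
  and emeasure_sphere_measure_sphere:
  "emeasure (sphere_measure :: 'a::euclidean_space measure) (sphere 0 1) = 1"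
proof -
  let ?b = "ball 0 1 :: 'a set"
  have fin: "emeasure lborel ?b < \<infinity>"
    by (rule emeasure_bounded_finite) simp
  have "emeasure lborel ?b \<noteq> 0"
    using content_ball_pos[of 1 "0::'a"] by (auto simp: measure_def)
  with fin have one: "emeasure lborel ?b / emeasure lborel ?b = 1"
    by (simp add: ennreal_divide_self)
  have m: "(\<lambda>x::'a. x /\<^sub>R norm x) \<in> measurable lborel borel"
    by measurable
  show "emeasure (sphere_measure :: 'a measure) UNIV = 1"
    using m by (simp add: sphere_measure_def emeasure_distr one)
  have vim: "(\<lambda>x::'a. x /\<^sub>R norm x) -` sphere 0 1 = - {0}"
    by (auto simp: divide_simps)
  have "emeasure lborel (?b \<inter> - {0}) = emeasure lborel ?b"
    using emeasure_Diff_null_set[of "{0}" lborel ?b] by (simp add: Diff_eq finite_imp_null_set_lborel)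
  then show "emeasure (sphere_measure :: 'a measure) (sphere 0 1) = 1"
    using m by (simp add: sphere_measure_def emeasure_distr vim one)
qed

text \<open>
  The Euclidean norm of \<open>'a \<times> 'a\<close> is the \<open>\<ell>\<^sup>2\<close> combination of the norms of the
  components, so for \<open>DIM('a) = d\<close> the variable \<open>w = (y, z)\<close> ranges over the unit sphere
  of dimension \<open>2d - 1\<close>. Where the integral does not converge absolutely, the Bochner
  integral is \<open>0\<close>; for a hypothesis of boundedness this is the least demanding convention.
\<close>

definition bilinear_spherical_maximal ::
    "real set \<Rightarrow> real set \<Rightarrow> ('a::euclidean_space \<Rightarrow> complex) \<Rightarrow> ('a \<Rightarrow> complex) \<Rightarrow> 'a \<Rightarrow> ennreal" where
  "bilinear_spherical_maximal E1 E2 f g x =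
     (SUP t1\<in>E1. SUP t2\<in>E2. ennreal (norm
        (\<integral>w. f (x - t1 *\<^sub>R fst w) * g (x - t2 *\<^sub>R snd w) \<partial>(sphere_measure :: ('a \<times> 'a) measure))))"

text \<open>Only used for exponents \<open>a > 0\<close>.\<close>

definition ennreal_powr :: "ennreal \<Rightarrow> real \<Rightarrow> ennreal" where
  "ennreal_powr x a = (if x = \<infinity> then \<infinity> else ennreal (enn2real x powr a))"

text \<open>
  The \<open>L\<^sup>p\<close> (quasi-)norm of a nonnegative function, for \<open>0 < p \<le> \<infinity>\<close>. It is meaningful
  as it stands only for measurable functions; the library's \<open>esssup\<close> is not used because it is
  \<open>\<infinity>\<close> on every non-measurable function.
\<close>

definition Lp_norm :: "ennreal \<Rightarrow> ('a::euclidean_space \<Rightarrow> ennreal) \<Rightarrow> ennreal" where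
  "Lp_norm p F =
     (if p = \<infinity> then Inf {c. AE x in lborel. F x \<le> c}
      else ennreal_powr (\<integral>\<^sup>+x. ennreal_powr (F x) (enn2real p) \<partial>lborel) (1 / enn2real p))"

text \<open>
  Elements of \<open>L\<^sup>p\<close> are given by Borel measurable representatives, which every class has.
  The maximal function does not depend on the choice: both marginals of the sphere measure on
  \<open>'a \<times> 'a\<close> are absolutely continuous with respect to Lebesgue measure, so changing
  \<open>f\<close> or \<open>g\<close> on a null set changes none of the integrals.
\<close>

definition in_Lp :: "ennreal \<Rightarrow> ('a::euclidean_space \<Rightarrow> complex) \<Rightarrow> bool" where
  "in_Lp p f \<longleftrightarrow> f \<in> borel_measurable borel \<and> Lp_norm p (\<lambda>x. ennreal (norm (f x))) < \<infinity>"

definition bounded_Lp_Lq_Lr ::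
    "ennreal \<Rightarrow> ennreal \<Rightarrow> ennreal \<Rightarrow>
     (('a::euclidean_space \<Rightarrow> complex) \<Rightarrow> ('a \<Rightarrow> complex) \<Rightarrow> 'a \<Rightarrow> ennreal) \<Rightarrow> bool" where
  "bounded_Lp_Lq_Lr p q r T \<longleftrightarrow>
     (\<exists>C::real. \<forall>f g. in_Lp p f \<longrightarrow> in_Lp q g \<longrightarrow>
        Lp_norm r (T f g) \<le>
          ennreal C * Lp_norm p (\<lambda>x. ennreal (norm (f x))) * Lp_norm q (\<lambda>x. ennreal (norm (g x))))"

definition covering_number :: "real set \<Rightarrow> real \<Rightarrow> nat" where
  "covering_number F \<delta> =
     (LEAST n. \<exists>A. finite A \<and> card A = n \<and> F \<subseteq> (\<Union>a\<in>A. {a..a + \<delta>}))"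

text \<open>Meaningful for nonempty bounded sets, for which the value lies in \<open>[0, 1]\<close>.\<close>

definition upper_minkowski_dim :: "real set \<Rightarrow> ereal" where
  "upper_minkowski_dim F =
     Limsup (at_right 0) (\<lambda>\<delta>. ereal (ln (real (covering_number F \<delta>)) / ln (1 / \<delta>)))"

definition E_star :: "real set \<Rightarrow> real set \<Rightarrow> real set" where
  "E_star E1 E2 = {t1 * t2 / sqrt (t1\<^sup>2 + t2\<^sup>2) | t1 t2. t1 \<in> E1 \<and> t2 \<in> E2}"

end

theory Submission
  imports Defs "HOL-Real_Asymp.Real_Asymp"
begin

text \<open>
  A Knapp example. For \<open>f = g\<close> the indicator of a plate of size
  \<open>\<delta>\<close> in one direction \<open>b0\<close> and \<open>\<surd>\<delta>\<close> in the others, the pairs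
  \<open>(x - t1 y, x - t2 z)\<close> trace an ellipsoid which, for \<open>x \<approx> e b0\<close> with
  \<open>e = t1 t2 / sqrt (t1\<^sup>2 + t2\<^sup>2)\<close>, passes through the origin with normal in the span of the
  two copies of \<open>b0\<close>. It therefore meets the product of the plates in a cap of measure
  \<open>\<sim> \<delta> (\<surd>\<delta>)\<^bsup>2d-2\<^esup> = \<delta>\<^sup>d\<close>. This holds for all \<open>x\<close> with \<open>b0\<close>-coordinate within
  \<open>\<delta>\<close> of \<open>E_star E1 E2\<close> and other coordinates at most \<open>\<surd>\<delta>\<close>, a set of measure
  \<open>\<gtrsim> N \<delta>\<^bsup>(d+1)/2\<^esup>\<close> with \<open>N\<close> the covering number of \<open>E_star E1 E2\<close>. Boundedness gives
  \<open>\<delta>\<^sup>d (N \<delta>\<^bsup>(d+1)/2\<^esup>)\<^bsup>1/r\<^esup> \<lesssim> \<delta>\<^bsup>(d+1)/2 (1/p + 1/q)\<^esup>\<close>; take logarithms and let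
  \<open>\<delta> \<rightarrow> 0\<close>.
\<close>

section \<open>Plates and their volumes\<close>

definition plate :: "'a::euclidean_space \<Rightarrow> real \<Rightarrow> real \<Rightarrow> real \<Rightarrow> 'a set" where
  "plate b0 l u s = {x. l \<le> x \<bullet> b0 \<and> x \<bullet> b0 \<le> u \<and> (\<forall>b\<in>Basis - {b0}. \<bar>x \<bullet> b\<bar> \<le> s)}"

lemma plate_eq_cbox:
  assumes "b0 \<in> Basis"
  shows "plate b0 l u s = cbox (\<Sum>b\<in>Basis. (if b = b0 then l else - s) *\<^sub>R b)
                               (\<Sum>b\<in>Basis. (if b = b0 then u else s) *\<^sub>R b)"
proof -
  have "(\<forall>b\<in>Basis. (if b = b0 then l else - s) \<le> x \<bullet> b \<and> x \<bullet> b \<le> (if b = b0 then u else s))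
      \<longleftrightarrow> l \<le> x \<bullet> b0 \<and> x \<bullet> b0 \<le> u \<and> (\<forall>b\<in>Basis - {b0}. \<bar>x \<bullet> b\<bar> \<le> s)" for x
    using assms by (auto simp: abs_le_iff minus_le_iff split: if_splits)
  then show ?thesis
    by (auto simp: plate_def mem_box)
qed

lemma plate_borel [measurable]:
  assumes "b0 \<in> Basis"
  shows "plate b0 l u s \<in> sets borel"
  by (simp add: plate_eq_cbox[OF assms])

lemma emeasure_plate:
  assumes "b0 \<in> (Basis :: 'a::euclidean_space set)" "l \<le> u" "0 \<le> s"
  shows "emeasure lborel (plate b0 l u s) = ennreal ((u - l) * (2 * s) ^ (DIM('a) - 1))"
proof -
  have "emeasure lborel (plate b0 l u s)
      = ennreal (\<Prod>b\<in>Basis. (if b = b0 then u - l else 2 * s))"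
    unfolding plate_eq_cbox[OF assms(1)] using assms
    by (subst emeasure_lborel_cbox) (auto simp: inner_diff_left intro!: arg_cong[where f=ennreal] prod.cong)
  also have "(\<Prod>b\<in>Basis. (if b = b0 then u - l else 2 * s))
     = (u - l) * (\<Prod>b\<in>Basis - {b0}. (if b = b0 then u - l else 2 * s))"
    using assms by (subst prod.remove[of _ b0]) auto
  also have "(\<Prod>b\<in>Basis - {b0}. (if b = b0 then u - l else 2 * s)) = (\<Prod>b\<in>Basis - {b0}. 2 * s)"
    by (intro prod.cong) auto
  also have "\<dots> = (2 * s) ^ (DIM('a) - 1)"
    using assms by simp
  finally show ?thesis .
qed

text \<open>Pythagoras, with the d - 1 transversal squares bounded crudely by d of them. For
  \<open>s = sqrt \<delta>\<close> the transversal part has order \<delta>, the same as the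
  thickness of the plate, which is why the norm of a cone point is controlled up to
  O(\<delta>).\<close>

lemma norm_square_plate:
  fixes s :: real
  assumes "b0 \<in> (Basis :: 'a::euclidean_space set)" "x \<in> plate b0 l u s" "0 \<le> s"
  shows "(x \<bullet> b0)\<^sup>2 \<le> (norm x)\<^sup>2" "(norm x)\<^sup>2 \<le> (x \<bullet> b0)\<^sup>2 + DIM('a) * s\<^sup>2"
proof -
  have eq: "(norm x)\<^sup>2 = (x \<bullet> b0)\<^sup>2 + (\<Sum>b\<in>Basis - {b0}. (x \<bullet> b)\<^sup>2)"
    unfolding power2_norm_eq_inner euclidean_inner[of x x] using assms(1)
    by (subst sum.remove[of _ b0]) (auto simp: power2_eq_square)
  have "(\<Sum>b\<in>Basis - {b0}. (x \<bullet> b)\<^sup>2) \<le> (\<Sum>b\<in>Basis - {b0}. s\<^sup>2)"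
    using assms by (intro sum_mono) (auto simp: plate_def abs_le_square_iff[symmetric])
  also have "\<dots> \<le> (\<Sum>b\<in>(Basis :: 'a set). s\<^sup>2)"
    by (intro sum_mono2) auto
  finally show "(norm x)\<^sup>2 \<le> (x \<bullet> b0)\<^sup>2 + DIM('a) * s\<^sup>2"
    using eq by simp
  show "(x \<bullet> b0)\<^sup>2 \<le> (norm x)\<^sup>2"
    using eq by (simp add: sum_nonneg)
qed

section \<open>Caps of the sphere measured by solid cones\<close>

text \<open>\<open>V\<close> lies in the truncated cone over \<open>A\<close>, whose relative volume
  in the ball is the sphere measure of \<open>A\<close>. Bounding a cap from below thus reduces to a
  Lebesgue volume in the doubled space.\<close>

lemma sphere_measure_ge_cone:
  fixes A V :: "'a::euclidean_space set"
  assumes "A \<in> sets borel" "V \<subseteq> ball 0 1" "\<And>v. v \<in> V \<Longrightarrow> v /\<^sub>R norm v \<in> A"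
  shows "emeasure lborel V / emeasure lborel (ball 0 1 :: 'a set) \<le> emeasure sphere_measure A"
proof -
  have m: "(\<lambda>x::'a. x /\<^sub>R norm x) \<in> measurable lborel borel"
    by measurable
  have "emeasure sphere_measure A
      = emeasure lborel (ball 0 1 \<inter> ((\<lambda>x::'a. x /\<^sub>R norm x) -` A)) / emeasure lborel (ball 0 1 :: 'a set)"
    using m assms(1) measurable_sets[OF m, of A]
    by (simp add: sphere_measure_def emeasure_distr)
  moreover have "emeasure lborel V \<le> emeasure lborel (ball 0 1 \<inter> ((\<lambda>x::'a. x /\<^sub>R norm x) -` A))"
    using assms m measurable_sets[OF m, of A] by (intro emeasure_mono) auto
  ultimately show ?thesis
    by (simp add: divide_right_mono_ennreal)
qed

text \<open>
  Projects radially into the cap. As a sheared box, it has its volume by Fubini.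
\<close>

definition knapp_cone :: "'a::euclidean_space \<Rightarrow> real \<Rightarrow> real \<Rightarrow> ('a \<times> 'a) set" where
  "knapp_cone b0 \<rho> \<delta> = {(y, z). y \<in> plate b0 (1/8) (1/4) (sqrt \<delta>) \<and>
      z \<in> plate b0 (\<rho> * (y \<bullet> b0) - \<delta>) (\<rho> * (y \<bullet> b0) + \<delta>) (sqrt \<delta>)}"

lemma knapp_cone_borel:
  assumes "b0 \<in> Basis"
  shows "knapp_cone b0 \<rho> \<delta> \<in> sets borel"
proof -
  have "knapp_cone b0 \<rho> \<delta> =
      {v. 1/8 \<le> fst v \<bullet> b0} \<inter> {v. fst v \<bullet> b0 \<le> 1/4}
      \<inter> {v. \<rho> * (fst v \<bullet> b0) - \<delta> \<le> snd v \<bullet> b0} \<inter> {v. snd v \<bullet> b0 \<le> \<rho> * (fst v \<bullet> b0) + \<delta>}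
      \<inter> (\<Inter>b\<in>Basis - {b0}. {v. \<bar>fst v \<bullet> b\<bar> \<le> sqrt \<delta>} \<inter> {v. \<bar>snd v \<bullet> b\<bar> \<le> sqrt \<delta>})"
    by (auto simp: knapp_cone_def plate_def)
  moreover have "closed \<dots>"
    by (intro closed_Int closed_INT closed_Collect_le continuous_intros ballI)
  ultimately have "closed (knapp_cone b0 \<rho> \<delta>)" by simp
  then show ?thesis by simp
qed

lemma emeasure_knapp_cone:
  assumes "b0 \<in> (Basis :: 'a::euclidean_space set)" "0 < \<delta>"
  shows "emeasure lborel (knapp_cone b0 \<rho> \<delta>) = ennreal (4 ^ (DIM('a) - 1) / 4 * \<delta> ^ DIM('a))"
proof -
  let ?Z = "(2 * \<delta>) * (2 * sqrt \<delta>) ^ (DIM('a) - 1)"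
  let ?Y = "plate b0 (1/8) (1/4) (sqrt \<delta>)"
  have "emeasure lborel (knapp_cone b0 \<rho> \<delta>)
      = emeasure (lborel \<Otimes>\<^sub>M lborel) (knapp_cone b0 \<rho> \<delta>)"
    by (simp add: lborel_prod)
  also have "\<dots> = (\<integral>\<^sup>+y. emeasure lborel (Pair y -` knapp_cone b0 \<rho> \<delta>) \<partial>lborel)"
  proof (rule lborel.emeasure_pair_measure_alt)
    show "knapp_cone b0 \<rho> \<delta> \<in> sets (lborel \<Otimes>\<^sub>M lborel)"
      using knapp_cone_borel[OF assms(1)] by (simp only: lborel_prod sets_lborel)
  qed
  \<comment> \<open>The fibre over \<open>y\<close> is a plate whose centre moves with
    \<open>y\<close> but whose size does not, so the inner measure is constant on
    \<open>?Y\<close>.\<close>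
  also have "\<dots> = (\<integral>\<^sup>+y. ennreal ?Z * indicator ?Y y \<partial>lborel)"
  proof (rule nn_integral_cong)
    fix y :: 'a
    have "Pair y -` knapp_cone b0 \<rho> \<delta> = (if y \<in> ?Y then
        plate b0 (\<rho> * (y \<bullet> b0) - \<delta>) (\<rho> * (y \<bullet> b0) + \<delta>) (sqrt \<delta>) else {})"
      by (auto simp: knapp_cone_def)
    then show "emeasure lborel (Pair y -` knapp_cone b0 \<rho> \<delta>) = ennreal ?Z * indicator ?Y y"
      using assms by (auto simp: emeasure_plate)
  qed
  also have "\<dots> = ennreal ?Z * emeasure lborel ?Y"
    using assms by (subst nn_integral_cmult_indicator) auto
  also have "\<dots> = ennreal (?Z * ((1/8) * (2 * sqrt \<delta>) ^ (DIM('a) - 1)))"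
    using assms by (subst emeasure_plate) (auto simp flip: ennreal_mult)
  also have "?Z * ((1/8) * (2 * sqrt \<delta>) ^ (DIM('a) - 1)) = 4 ^ (DIM('a) - 1) / 4 * \<delta> ^ DIM('a)"
  proof -
    \<comment> \<open>The d - 1 transversal widths of \<open>y\<close> and of \<open>z\<close> pair
      up, so the square roots disappear.\<close>
    have "?Z * ((1/8) * (2 * sqrt \<delta>) ^ (DIM('a) - 1))
       = \<delta> / 4 * ((2 * sqrt \<delta>) * (2 * sqrt \<delta>)) ^ (DIM('a) - 1)"
      unfolding power_mult_distrib by (simp add: field_simps)
    also have "(2 * sqrt \<delta>) * (2 * sqrt \<delta>) = 4 * \<delta>"
      using assms by simp
    also have "\<delta> / 4 * (4 * \<delta>) ^ (DIM('a) - 1) = 4 ^ (DIM('a) - 1) / 4 * (\<delta> * \<delta> ^ (DIM('a) - 1))"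
      by (simp add: power_mult_distrib)
    also have "\<delta> * \<delta> ^ (DIM('a) - 1) = \<delta> ^ DIM('a)"
      using DIM_positive[where 'a='a] by (metis power_eq_if not_gr_zero)
    finally show ?thesis .
  qed
  finally show ?thesis .
qed

section \<open>Projecting the cone to the sphere\<close>

text \<open>Here \<open>n\<close> is the norm of a cone point and \<open>a * s\<close> that of a
  nearby point on the axis. Since \<open>n + a * s\<close> is at least 1/4, closeness of the squares
  gives closeness within \<open>4 * B\<close>; dividing by \<open>n * s\<close>, which is at least
  1/8, yields 32.\<close>

lemma normalize_ratio_bound:
  fixes a n s B :: real
  assumes "1/8 \<le> a" "a \<le> n" "1 \<le> s" "\<bar>n\<^sup>2 - (a * s)\<^sup>2\<bar> \<le> B"
  shows "\<bar>a / n - 1 / s\<bar> \<le> 32 * B"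
proof -
  have as: "1/8 \<le> a * s"
    using mult_mono[of "1/8" a 1 s] assms by simp
  have n: "1/8 \<le> n" using assms by simp
  have ns: "1/8 \<le> n * s"
    using mult_mono[of "1/8" n 1 s] assms n by simp
  have "\<bar>n - a * s\<bar> * (1/4) \<le> \<bar>n - a * s\<bar> * (n + a * s)"
    using as n by (intro mult_left_mono) auto
  also have "\<dots> = \<bar>n\<^sup>2 - (a * s)\<^sup>2\<bar>"
    using as n by (simp add: abs_mult power2_eq_square square_diff_square_factored)
  finally have d: "\<bar>n - a * s\<bar> \<le> 4 * B"
    using assms by simp
  then have B: "0 \<le> B" by simp
  have "a / n - 1 / s = (a * s - n) / (n * s)"
    using n assms by (simp add: field_simps)
  then have "\<bar>a / n - 1 / s\<bar> = \<bar>n - a * s\<bar> / (n * s)"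
    using n assms by (simp add: abs_mult abs_minus_commute)
  also have "\<dots> \<le> (4 * B) / (1/8)"
    using d ns B by (intro frac_le) auto
  finally show ?thesis by simp
qed

text \<open>At a point of the axis, where \<open>y\<close> is \<open>a\<close> times
  \<open>b0\<close> and \<open>z\<close> is \<open>\<rho> * a\<close> times \<open>b0\<close> with
  \<open>\<rho> = t1 / t2\<close>, the norm is \<open>a * sqrt (1 + \<rho>\<^sup>2)\<close>. After
  normalization \<open>t1\<close> times the first coordinate and \<open>t2\<close> times the second
  are then both exactly \<open>e\<close>. Leaving the axis changes the squared norm only by
  O(\<delta>).\<close>

lemma knapp_cone_estimates:
  fixes y z :: "'a::euclidean_space" and \<delta> :: real
  assumes b0: "b0 \<in> Basis" and \<delta>: "0 < \<delta>" "\<delta> \<le> 1 / (16 * DIM('a))"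
    and t: "t1 \<in> {1..2}" "t2 \<in> {1..2}"
    and v: "(y, z) \<in> knapp_cone b0 (t1 / t2) \<delta>"
  defines "n \<equiv> norm (y, z)" and "e \<equiv> t1 * t2 / sqrt (t1\<^sup>2 + t2\<^sup>2)"
  shows "n < 1" "1/8 \<le> n"
    and "\<bar>t1 * (y \<bullet> b0 / n) - e\<bar> \<le> 256 * DIM('a) * \<delta>"
    and "\<bar>t2 * (z \<bullet> b0 / n) - e\<bar> \<le> 272 * DIM('a) * \<delta>"
proof -
  define D where "D = real DIM('a)"
  define \<rho> where "\<rho> = t1 / t2"
  define a where "a = y \<bullet> b0"
  define \<eta> where "\<eta> = z \<bullet> b0 - \<rho> * a"
  have D: "1 \<le> D"
    unfolding D_def using DIM_positive[where 'a='a] by linarith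
  have \<delta>D: "D * \<delta> \<le> 1/16"
    using \<delta>(2) D by (simp add: D_def[symmetric] field_simps)
  have \<delta>1: "\<delta> \<le> D * \<delta>"
    using D \<delta>(1) by simp
  have \<rho>: "0 < \<rho>" "\<rho> \<le> 2"
    using t by (auto simp: \<rho>_def field_simps)
  have yp: "y \<in> plate b0 (1/8) (1/4) (sqrt \<delta>)"
    and zp: "z \<in> plate b0 (\<rho> * a - \<delta>) (\<rho> * a + \<delta>) (sqrt \<delta>)"
    using v by (auto simp: knapp_cone_def \<rho>_def a_def)
  have a: "1/8 \<le> a" "a \<le> 1/4"
    using yp by (auto simp: plate_def a_def)
  have \<eta>: "\<bar>\<eta>\<bar> \<le> \<delta>"
    using zp by (auto simp: plate_def \<eta>_def)
  have zb: "z \<bullet> b0 = \<rho> * a + \<eta>" by (simp add: \<eta>_def)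
  have \<rho>a: "0 \<le> \<rho> * a" "\<rho> * a \<le> 1/2"
    using \<rho> a mult_mono[of \<rho> 2 a "1/4"] by auto
  have n2: "n\<^sup>2 = (norm y)\<^sup>2 + (norm z)\<^sup>2"
    by (simp add: n_def norm_Pair)
  have s\<delta>: "(sqrt \<delta>)\<^sup>2 = \<delta>" using \<delta> by simp
  note ny = norm_square_plate[OF b0 yp] and nz = norm_square_plate[OF b0 zp]
  have lo: "a\<^sup>2 + (\<rho> * a + \<eta>)\<^sup>2 \<le> n\<^sup>2" and hi: "n\<^sup>2 \<le> a\<^sup>2 + (\<rho> * a + \<eta>)\<^sup>2 + 2 * D * \<delta>"
    using ny nz \<delta> by (auto simp: n2 zb s\<delta> D_def a_def)
  have n0: "0 \<le> n" by (simp add: n_def)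
  have "a\<^sup>2 \<le> (1/4)\<^sup>2" using a by (intro power_mono) auto
  \<comment> \<open>9/16 is 1/2 from \<open>\<rho> * a\<close> plus 1/16 from \<open>\<eta>\<close>.
    The squared norm is then at most 1/16 + 81/256 + 1/8, which is below 1.\<close>
  moreover have "(\<rho> * a + \<eta>)\<^sup>2 \<le> (9/16)\<^sup>2"
  proof -
    have "\<bar>\<rho> * a + \<eta>\<bar> \<le> \<bar>9/16\<bar>"
      using \<rho>a \<eta> \<delta>1 \<delta>D by linarith
    then show ?thesis by (rule abs_le_square_iff[THEN iffD1])
  qed
  ultimately have "n\<^sup>2 < 1\<^sup>2"
    using hi \<delta>D by (simp add: power2_eq_square)
  then show "n < 1"
    by (rule power_less_imp_less_base) simp
  have "a\<^sup>2 \<le> n\<^sup>2" using lo by (smt (verit) zero_le_power2)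
  then have an: "a \<le> n" using n0 by (rule power2_le_imp_le)
  then show n8: "1/8 \<le> n" using a by simp
  define s where "s = sqrt (1 + \<rho>\<^sup>2)"
  have s: "1 \<le> s" by (simp add: s_def)
  have as: "(a * s)\<^sup>2 = a\<^sup>2 + (\<rho> * a)\<^sup>2"
    by (simp add: s_def power_mult_distrib algebra_simps)
  have "\<bar>2 * (\<rho> * a) * \<eta>\<bar> \<le> \<delta>"
    using mult_mono[of "\<bar>2 * (\<rho> * a)\<bar>" 1 "\<bar>\<eta>\<bar>" \<delta>] \<rho>a \<eta> \<delta> by (simp add: abs_mult)
  moreover have "\<eta>\<^sup>2 \<le> \<delta>"
  proof -
    have "\<eta>\<^sup>2 \<le> \<delta>\<^sup>2" using \<eta> \<delta> by (subst abs_le_square_iff[symmetric]) auto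
    also have "\<delta>\<^sup>2 \<le> \<delta>"
    proof -
      have "\<delta> \<le> 1" using \<delta>1 \<delta>D by linarith
      then show ?thesis using \<delta>(1) by (simp add: power2_eq_square mult_left_le_one_le)
    qed
    finally show ?thesis .
  qed
  moreover have "(\<rho> * a + \<eta>)\<^sup>2 = (\<rho> * a)\<^sup>2 + 2 * (\<rho> * a) * \<eta> + \<eta>\<^sup>2"
    by (simp add: power2_sum)
  moreover have "0 \<le> \<eta>\<^sup>2" by simp
  \<comment> \<open>The transversal coordinates contribute \<open>2 * D * \<delta>\<close>, the
    cross term and the square of \<open>\<eta>\<close> one \<delta> each.\<close>
  ultimately have "\<bar>n\<^sup>2 - (a * s)\<^sup>2\<bar> \<le> 4 * D * \<delta>"
    using lo hi as \<delta>1 \<delta>(1) unfolding abs_le_iff mult.assoc by linarith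
  from normalize_ratio_bound[OF a(1) an s this]
  have r: "\<bar>a / n - 1 / s\<bar> \<le> 128 * D * \<delta>" by simp
  have "t2 * s = sqrt (t1\<^sup>2 + t2\<^sup>2)"
  proof -
    have "t2 * s = sqrt (t2\<^sup>2 * (1 + \<rho>\<^sup>2))"
      using t by (simp add: s_def real_sqrt_mult)
    also have "t2\<^sup>2 * (1 + \<rho>\<^sup>2) = t1\<^sup>2 + t2\<^sup>2"
      using t by (simp add: \<rho>_def power_divide field_simps)
    finally show ?thesis .
  qed
  then have e: "e = t1 * (1 / s)"
    using t s by (simp add: e_def field_simps flip: \<open>t2 * s = sqrt (t1\<^sup>2 + t2\<^sup>2)\<close>)
  have "t1 * (a / n) - e = t1 * (a / n - 1 / s)"
    unfolding e by (rule right_diff_distrib[symmetric])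
  then have "\<bar>t1 * (a / n) - e\<bar> = t1 * \<bar>a / n - 1 / s\<bar>"
    using t by (simp only: abs_mult) simp
  also have "\<dots> \<le> 2 * (128 * D * \<delta>)"
    using t r by (intro mult_mono) auto
  finally show 1: "\<bar>t1 * (y \<bullet> b0 / n) - e\<bar> \<le> 256 * DIM('a) * \<delta>"
    by (simp add: a_def D_def)
  \<comment> \<open>As \<open>t2 * \<rho> = t1\<close>, the second quantity differs from the first
    only through \<open>\<eta>\<close>. That term is at most \<open>16 * \<delta>\<close>, hence 272
    = 256 + 16.\<close>
  have "t2 * (z \<bullet> b0 / n) - e = (t1 * (a / n) - e) + t2 * \<eta> / n"
    using t by (simp add: zb \<rho>_def add_divide_distrib distrib_left)
  then have "\<bar>t2 * (z \<bullet> b0 / n) - e\<bar> \<le> \<bar>t1 * (a / n) - e\<bar> + \<bar>t2 * \<eta> / n\<bar>"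
    by (simp only: abs_triangle_ineq)
  also have "\<bar>t2 * \<eta> / n\<bar> \<le> (2 * \<delta>) / (1/8)"
    unfolding abs_divide abs_mult using t \<eta> n8 \<delta> by (intro frac_le mult_mono) auto
  also have "\<bar>t1 * (a / n) - e\<bar> \<le> 256 * D * \<delta>"
    using 1 by (simp add: a_def D_def)
  also have "256 * D * \<delta> + (2 * \<delta>) / (1/8) \<le> 272 * D * \<delta>"
    using \<delta>1 by simp
  finally show "\<bar>t2 * (z \<bullet> b0 / n) - e\<bar> \<le> 272 * DIM('a) * \<delta>"
    by (simp add: D_def)
qed


text \<open>The target plate depends on \<delta> alone, not on the radii or on \<open>x\<close>: the
  radii enter only through \<open>e\<close>, which \<open>x\<close> compensates. The factor 300
  leaves room for 272 + 1 along \<open>b0\<close> and for 17 across.\<close>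

lemma knapp_cone_cap:
  fixes x y z :: "'a::euclidean_space" and \<delta> :: real
  assumes b0: "b0 \<in> Basis" and \<delta>: "0 < \<delta>" "\<delta> \<le> 1 / (16 * DIM('a))"
    and t: "t1 \<in> {1..2}" "t2 \<in> {1..2}"
    and v: "(y, z) \<in> knapp_cone b0 (t1 / t2) \<delta>"
    and x: "\<bar>x \<bullet> b0 - t1 * t2 / sqrt (t1\<^sup>2 + t2\<^sup>2)\<bar> \<le> \<delta>" "\<forall>b\<in>Basis - {b0}. \<bar>x \<bullet> b\<bar> \<le> sqrt \<delta>"
  defines "K \<equiv> 300 * real DIM('a)"
  shows "x - t1 *\<^sub>R (y /\<^sub>R norm (y, z)) \<in> plate b0 (- (K * \<delta>)) (K * \<delta>) (K * sqrt \<delta>)"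
    and "x - t2 *\<^sub>R (z /\<^sub>R norm (y, z)) \<in> plate b0 (- (K * \<delta>)) (K * \<delta>) (K * sqrt \<delta>)"
proof -
  note est = knapp_cone_estimates[OF b0 \<delta> t v]
  define n where "n = norm (y, z)"
  define D where "D = real DIM('a)"
  have D: "1 \<le> D"
    unfolding D_def using DIM_positive[where 'a='a] by linarith
  have \<delta>1: "\<delta> \<le> D * \<delta>"
    using D \<delta>(1) by simp
  have n: "1/8 \<le> n" using est(2) by (simp add: n_def)
  \<comment> \<open>One argument for both components: \<open>(t, w)\<close> becomes
    \<open>(t1, y)\<close> and then \<open>(t2, z)\<close>. Across \<open>b0\<close>, the bounds
    \<open>t \<le> 2\<close> and \<open>n \<ge> 1/8\<close> give the factor 16.\<close>
  have gen: "x - t *\<^sub>R (w /\<^sub>R n) \<in> plate b0 (- (K * \<delta>)) (K * \<delta>) (K * sqrt \<delta>)"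
    if t: "t \<in> {1..2}" and w: "\<forall>b\<in>Basis - {b0}. \<bar>w \<bullet> b\<bar> \<le> sqrt \<delta>"
      and m: "\<bar>t * (w \<bullet> b0 / n) - t1 * t2 / sqrt (t1\<^sup>2 + t2\<^sup>2)\<bar> \<le> 272 * D * \<delta>" for t w
  proof -
    have "\<bar>x \<bullet> b0 - t * (w \<bullet> b0 / n)\<bar> \<le> 300 * (D * \<delta>)"
    proof -
      have "\<bar>u - v\<bar> \<le> 300 * k" if "\<bar>v - c\<bar> \<le> 272 * k" "\<bar>u - c\<bar> \<le> \<delta>" "\<delta> \<le> k" for u v c k :: real
        using that \<delta>(1) by linarith
      from this[OF _ x(1) \<delta>1] m show ?thesis
        unfolding mult.assoc by blast
    qed
    moreover have "\<bar>x \<bullet> b - t * (w \<bullet> b / n)\<bar> \<le> 300 * D * sqrt \<delta>" if "b \<in> Basis - {b0}" for b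
    proof -
      have "\<bar>t * (w \<bullet> b / n)\<bar> = t * (\<bar>w \<bullet> b\<bar> / n)"
        using t n by (simp add: abs_mult)
      also have "\<dots> \<le> 2 * (sqrt \<delta> / (1/8))"
        using t n w that \<delta> by (intro mult_mono frac_le) auto
      finally have "\<bar>t * (w \<bullet> b / n)\<bar> \<le> 16 * sqrt \<delta>" by simp
      moreover have "\<bar>x \<bullet> b\<bar> \<le> sqrt \<delta>" using x(2) that by blast
      ultimately have "\<bar>x \<bullet> b - t * (w \<bullet> b / n)\<bar> \<le> sqrt \<delta> + 16 * sqrt \<delta>"
        by (intro order_trans[OF abs_triangle_ineq4] add_mono)
      also have "\<dots> = 17 * sqrt \<delta>" by simp
      also have "17 * sqrt \<delta> \<le> (300 * D) * sqrt \<delta>"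
        using D \<delta> by (intro mult_right_mono) auto
      finally show ?thesis .
    qed
    ultimately show ?thesis
      by (auto simp: plate_def K_def D_def inner_diff_left divide_inverse mult_ac abs_le_iff)
  qed
  have yz: "\<forall>b\<in>Basis - {b0}. \<bar>y \<bullet> b\<bar> \<le> sqrt \<delta>" "\<forall>b\<in>Basis - {b0}. \<bar>z \<bullet> b\<bar> \<le> sqrt \<delta>"
    using v by (auto simp: knapp_cone_def plate_def)
  show "x - t1 *\<^sub>R (y /\<^sub>R norm (y, z)) \<in> plate b0 (- (K * \<delta>)) (K * \<delta>) (K * sqrt \<delta>)"
    using gen[OF t(1) yz(1) order_trans[OF est(3)[folded n_def D_def]]] D \<delta>(1) by (simp add: n_def D_def)
  show "x - t2 *\<^sub>R (z /\<^sub>R norm (y, z)) \<in> plate b0 (- (K * \<delta>)) (K * \<delta>) (K * sqrt \<delta>)"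
    using gen[OF t(2) yz(2)] est(4) by (simp add: n_def D_def)
qed

section \<open>The maximal function and norms of indicators\<close>

text \<open>The product of the two indicators is the indicator of one set of directions, so each
  integral is the measure of that set, finite because the total mass is 1. The supremum dominates
  any single choice of radii.\<close>

lemma bilinear_spherical_maximal_indicator_ge:
  fixes P :: "'a::euclidean_space set"
  assumes "P \<in> sets borel" "t1 \<in> E1" "t2 \<in> E2"
  shows "emeasure sphere_measure {w :: 'a \<times> 'a. x - t1 *\<^sub>R fst w \<in> P \<and> x - t2 *\<^sub>R snd w \<in> P}
    \<le> bilinear_spherical_maximal E1 E2 (indicator P) (indicator P) x"
proof -
  let ?M = "sphere_measure :: ('a \<times> 'a) measure"
  let ?W = "{w :: 'a \<times> 'a. x - t1 *\<^sub>R fst w \<in> P \<and> x - t2 *\<^sub>R snd w \<in> P}"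
  have space: "space ?M = UNIV"
    by (simp add: sphere_measure_def)
  then have "emeasure ?M ?W \<le> 1"
    using emeasure_space[of ?M ?W] by (simp add: emeasure_sphere_measure_UNIV)
  then have fin: "emeasure ?M ?W \<noteq> \<infinity>"
    by (auto simp: top_unique)
  have "(\<integral>w. indicator P (x - t1 *\<^sub>R fst w) * indicator P (x - t2 *\<^sub>R snd w) \<partial>?M)
      = (\<integral>w. complex_of_real (indicator ?W w) \<partial>?M)"
    by (intro Bochner_Integration.integral_cong) (auto simp: indicator_def)
  also have "\<dots> = complex_of_real (measure ?M ?W)"
    using space by simp
  finally have "ennreal (norm (\<integral>w. (indicator P (x - t1 *\<^sub>R fst w) :: complex)
      * indicator P (x - t2 *\<^sub>R snd w) \<partial>?M)) = emeasure ?M ?W"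
    using fin by (simp add: emeasure_eq_ennreal_measure)
  then show ?thesis
    unfolding bilinear_spherical_maximal_def using assms(2,3)
    by (intro SUP_upper2[of t1] SUP_upper2[of t2]) auto
qed

lemma ennreal_powr_mono:
  assumes "x \<le> y" "0 \<le> a"
  shows "ennreal_powr x a \<le> ennreal_powr y a"
  using assms by (auto simp: ennreal_powr_def top_unique less_top intro!: ennreal_leI powr_mono2 enn2real_mono)

lemma enn2real_inverse: "0 < p \<Longrightarrow> p \<noteq> \<infinity> \<Longrightarrow> enn2real (1 / p) = 1 / enn2real p"
  by (cases p) (auto simp: divide_ennreal_def inverse_ennreal enn2real_mult inverse_eq_divide)

text \<open>One formula covers all exponents: at \<open>p = \<infinity>\<close> the value
  \<open>enn2real (1 / p)\<close> is 0, and \<open>m powr 0 = 1\<close> because \<open>m\<close> is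
  positive.\<close>

lemma Lp_norm_indicator_le:
  fixes P :: "'a::euclidean_space set"
  assumes "P \<in> sets borel" "emeasure lborel P = ennreal m" "0 < m" "0 < p"
  shows "Lp_norm p (\<lambda>x. ennreal (norm (indicator P x :: complex))) \<le> ennreal (m powr enn2real (1 / p))"
proof (cases "p = \<infinity>")
  case True
  then show ?thesis
    using assms(3) by (auto simp: Lp_norm_def indicator_def intro!: Inf_lower)
next
  case False
  then have p: "0 < enn2real p"
    using assms(4) by (simp add: enn2real_positive_iff less_top)
  have "ennreal_powr (ennreal (norm (indicator P x :: complex))) (enn2real p) = indicator P x" for x
    using p by (auto simp: ennreal_powr_def indicator_def)
  then have "Lp_norm p (\<lambda>x. ennreal (norm (indicator P x :: complex)))
      = ennreal_powr (emeasure lborel P) (1 / enn2real p)"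
    using False assms(1) by (simp add: Lp_norm_def)
  also have "\<dots> = ennreal (m powr enn2real (1 / p))"
    using assms False by (simp add: ennreal_powr_def enn2real_inverse)
  finally show ?thesis by simp
qed

text \<open>Chebyshev's inequality. Finite exponents use monotonicity of the nonnegative integral,
  valid for arbitrary functions; at \<open>r = \<infinity>\<close> a bound not above
  \<open>c\<close> would make \<open>X\<close> a null set. This suits a supremum over possibly
  uncountably many radii.\<close>

lemma Lp_norm_ge:
  fixes X :: "'a::euclidean_space set"
  assumes "X \<in> sets borel" "emeasure lborel X = ennreal m" "0 < m" "0 < r" "0 < c"
    and "\<And>x. x \<in> X \<Longrightarrow> ennreal c \<le> F x"
  shows "ennreal (c * m powr enn2real (1 / r)) \<le> Lp_norm r F"
proof (cases "r = \<infinity>")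
  case True
  have "ennreal c \<le> k" if "AE x in lborel. F x \<le> k" for k
  proof (rule ccontr)
    assume "\<not> ennreal c \<le> k"
    then have "AE x in lborel. x \<notin> X"
      using that assms(6) by (elim AE_mp) (auto intro!: AE_I2 dest: order_trans)
    then have "emeasure lborel X = 0"
      using assms(1) by (subst (asm) AE_iff_measurable[of X]) auto
    then show False using assms by simp
  qed
  then show ?thesis
    using True assms(3) by (auto simp: Lp_norm_def intro!: Inf_greatest)
next
  case False
  then have r: "0 < enn2real r"
    using assms(4) by (simp add: enn2real_positive_iff less_top)
  have "ennreal (c powr enn2real r * m) = (\<integral>\<^sup>+x. ennreal (c powr enn2real r) * indicator X x \<partial>lborel)"
    using assms by (subst nn_integral_cmult_indicator) (auto simp: ennreal_mult)
  also have "\<dots> \<le> (\<integral>\<^sup>+x. ennreal_powr (F x) (enn2real r) \<partial>lborel)"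
  proof (rule nn_integral_mono)
    fix x
    show "ennreal (c powr enn2real r) * indicator X x \<le> ennreal_powr (F x) (enn2real r)"
      using ennreal_powr_mono[OF assms(6), of x "enn2real r"] r assms(5)
      by (auto simp: indicator_def ennreal_powr_def)
  qed
  finally have "ennreal_powr (ennreal (c powr enn2real r * m)) (1 / enn2real r) \<le> Lp_norm r F"
    using False r by (simp add: Lp_norm_def ennreal_powr_mono)
  moreover have "ennreal_powr (ennreal (c powr enn2real r * m)) (1 / enn2real r)
      = ennreal (c * m powr enn2real (1 / r))"
    using assms r False by (simp add: ennreal_powr_def powr_mult powr_powr enn2real_inverse)
  ultimately show ?thesis by simp
qed

section \<open>Covering numbers and grids\<close>

lemma E_star_subset:
  assumes "E1 \<subseteq> {1..2}" "E2 \<subseteq> {1..2}"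
  shows "E_star E1 E2 \<subseteq> {0..2}"
proof
  fix e assume "e \<in> E_star E1 E2"
  then obtain t1 t2 where e: "e = t1 * t2 / sqrt (t1\<^sup>2 + t2\<^sup>2)" and "t1 \<in> E1" "t2 \<in> E2"
    by (auto simp: E_star_def)
  with assms have t: "1 \<le> t1" "t1 \<le> 2" "1 \<le> t2" "t2 \<le> 2" by auto
  have "t2 \<le> sqrt (t1\<^sup>2 + t2\<^sup>2)" by simp
  then have "t1 * t2 \<le> 2 * sqrt (t1\<^sup>2 + t2\<^sup>2)"
    using t by (intro mult_mono) auto
  then show "e \<in> {0..2}"
    using t by (auto simp: e divide_le_eq sum_power2_gt_zero_iff)
qed

lemma floor_grid:
  fixes e \<delta> :: real
  assumes "0 < \<delta>"
  shows "of_int \<lfloor>e / \<delta>\<rfloor> * \<delta> \<le> e" "e \<le> (of_int \<lfloor>e / \<delta>\<rfloor> + 1) * \<delta>"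
  using of_int_floor_le[of "e / \<delta>"] real_of_int_floor_add_one_ge[of "e / \<delta>"] assms
  by (simp_all only: pos_le_divide_eq pos_divide_le_eq)

text \<open>The grid cells meeting \<open>F\<close> form an admissible covering. Counting cells
  instead of an optimal covering loses nothing for a lower bound and provides essentially disjoint
  pieces whose volumes can be added.\<close>

lemma covering_number_le_grid:
  assumes "F \<subseteq> {a..b}" "F \<noteq> {}" "0 < \<delta>"
  shows "finite ((\<lambda>e. \<lfloor>e / \<delta>\<rfloor>) ` F)"
    and "1 \<le> covering_number F \<delta>"
    and "covering_number F \<delta> \<le> card ((\<lambda>e. \<lfloor>e / \<delta>\<rfloor>) ` F)"
proof -
  let ?K = "(\<lambda>e. \<lfloor>e / \<delta>\<rfloor>) ` F"
  have "a \<le> e" "e \<le> b" if "e \<in> F" for e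
    using assms(1) that by auto
  then have "?K \<subseteq> {\<lfloor>a / \<delta>\<rfloor>..\<lfloor>b / \<delta>\<rfloor>}"
    using assms(3) by (auto intro!: floor_mono divide_right_mono)
  then show fin: "finite ?K"
    by (rule finite_subset) simp
  let ?P = "\<lambda>n. \<exists>A. finite A \<and> card A = n \<and> F \<subseteq> (\<Union>a\<in>A. {a..a + \<delta>})"
  let ?A = "(\<lambda>k. of_int k * \<delta>) ` ?K"
  have "F \<subseteq> (\<Union>a\<in>?A. {a..a + \<delta>})"
  proof
    fix e assume e: "e \<in> F"
    show "e \<in> (\<Union>a\<in>?A. {a..a + \<delta>})"
      using e floor_grid[OF assms(3), of e] by (auto simp: algebra_simps)
  qed
  then have P: "?P (card ?A)"
    using fin by blast
  have "covering_number F \<delta> \<le> card ?A"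
    unfolding covering_number_def using P by (rule Least_le)
  also have "\<dots> \<le> card ?K"
    using fin by (rule card_image_le)
  finally show "covering_number F \<delta> \<le> card ?K" .
  \<comment> \<open>The grid covering shows that the \<open>LEAST\<close> is attained; a covering of
    a nonempty set uses at least one interval.\<close>
  obtain A where "finite A" "card A = covering_number F \<delta>" "F \<subseteq> (\<Union>a\<in>A. {a..a + \<delta>})"
    using LeastI[of ?P, OF P] unfolding covering_number_def by blast
  then show "1 \<le> covering_number F \<delta>"
    using assms(2) by (cases "A = {}") (auto simp: Suc_le_eq card_gt_0_iff)
qed

section \<open>From power bounds to the Minkowski dimension\<close>

text \<open>Take logarithms and divide by \<open>ln (1 / \<delta>)\<close>: the multiplicative
  constants, collected in \<open>\<kappa>\<close>, vanish in the limit and only the exponents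
  remain.\<close>

lemma Limsup_log_ratio_le:
  fixes N :: "real \<Rightarrow> nat" and A B C M D h \<rho> \<sigma> \<beta> \<delta>0 :: real
  assumes pos: "0 < A" "0 < B" "0 < M" "0 < \<delta>0" "0 \<le> \<rho>"
    and N: "\<And>\<delta>. 0 < \<delta> \<Longrightarrow> \<delta> < \<delta>0 \<Longrightarrow> 1 \<le> N \<delta>"
    and le: "\<And>\<delta>. 0 < \<delta> \<Longrightarrow> \<delta> < \<delta>0 \<Longrightarrow>
      A * \<delta> powr D * (B * N \<delta> * \<delta> powr h) powr \<rho> \<le> C * (M * \<delta> powr h) powr \<sigma>"
    and \<beta>: "Limsup (at_right 0) (\<lambda>\<delta>. ereal (ln (real (N \<delta>)) / ln (1 / \<delta>))) = ereal \<beta>"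
  shows "\<rho> * \<beta> \<le> D + h * \<rho> - h * \<sigma>"
proof -
  define \<gamma> where "\<gamma> = D + h * \<rho> - h * \<sigma>"
  define \<kappa> where "\<kappa> = ln C + \<sigma> * ln M - ln A - \<rho> * ln B"
  have bound: "\<rho> * (ln (N \<delta>) / ln (1 / \<delta>)) \<le> \<gamma> + \<kappa> / ln (1 / \<delta>)"
    if \<delta>: "0 < \<delta>" "\<delta> < min 1 \<delta>0" for \<delta>
  proof -
    have N1: "1 \<le> real (N \<delta>)"
      using N[of \<delta>] \<delta> by simp
    have l: "0 < A * \<delta> powr D * (B * N \<delta> * \<delta> powr h) powr \<rho>"
      using pos \<delta> N1 by simp
    also have r: "\<dots> \<le> C * (M * \<delta> powr h) powr \<sigma>"
      using le \<delta> by simp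
    \<comment> \<open>The positive left side forces \<open>C\<close> to be positive, so taking its
      logarithm is legitimate.\<close>
    finally have C: "0 < C"
      using pos \<delta> by (simp add: zero_less_mult_iff)
    have "ln (A * \<delta> powr D * (B * N \<delta> * \<delta> powr h) powr \<rho>) \<le> ln (C * (M * \<delta> powr h) powr \<sigma>)"
      using l r by simp
    then have "ln A + D * ln \<delta> + \<rho> * (ln B + ln (N \<delta>) + h * ln \<delta>) \<le> ln C + \<sigma> * (ln M + h * ln \<delta>)"
      using pos \<delta> N1 C by (simp add: ln_mult ln_powr)
    then have "\<rho> * ln (N \<delta>) \<le> \<gamma> * ln (1 / \<delta>) + \<kappa>"
      using \<delta> by (simp add: \<gamma>_def \<kappa>_def ln_div algebra_simps)
    moreover have "0 < ln (1 / \<delta>)"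
      using \<delta> by simp
    ultimately show ?thesis
      by (simp add: field_simps)
  qed
  have ev: "\<forall>\<^sub>F \<delta> in at_right 0. \<rho> * (ln (N \<delta>) / ln (1 / \<delta>)) \<le> \<gamma> + \<kappa> / ln (1 / \<delta>)"
  proof (rule eventually_mono)
    show "\<forall>\<^sub>F \<delta> in at_right 0. \<delta> \<in> {0<..<min 1 \<delta>0}"
      using pos by (intro eventually_at_right_real) simp
  qed (rule bound, auto)
  have "((\<lambda>\<delta>::real. \<kappa> / ln (1 / \<delta>)) \<longlongrightarrow> 0) (at_right 0)"
    by real_asymp
  then have lim: "((\<lambda>\<delta>. \<gamma> + \<kappa> / ln (1 / \<delta>)) \<longlongrightarrow> \<gamma>) (at_right 0)"
    using tendsto_add[OF tendsto_const, of _ 0] by fastforce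
  show ?thesis
  \<comment> \<open>The case \<open>\<rho> = 0\<close> corresponds to r = \<infinity>. Division by
    \<open>\<rho>\<close> is then impossible, but the limit of the bound itself gives
    \<open>0 \<le> \<gamma>\<close>.\<close>
  proof (cases "\<rho> = 0")
    case True
    then have "0 \<le> \<gamma>"
      using lim ev by (intro tendsto_lowerbound[OF lim]) auto
    then show ?thesis
      using True by (simp add: \<gamma>_def)
  next
    case False
    then have \<rho>: "0 < \<rho>" using pos by simp
    have "ereal \<beta> \<le> Limsup (at_right 0) (\<lambda>\<delta>. ereal ((\<gamma> + \<kappa> / ln (1 / \<delta>)) / \<rho>))"
      unfolding \<beta>[symmetric] using ev \<rho>
      by (intro Limsup_mono) (auto elim!: eventually_mono simp: field_simps)
    also have "\<dots> = ereal (\<gamma> / \<rho>)"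
      using lim \<rho> by (intro lim_imp_Limsup tendsto_intros) auto
    finally show ?thesis
      using \<rho> by (simp add: field_simps \<gamma>_def)
  qed
qed

section \<open>Testing boundedness on one plate\<close>

text \<open>On the left stand the cap measure and, inside \<open>powr\<close>, a lower bound for the
  volume of the set of \<open>x\<close> where it is attained; on the right, the volume of the plate
  whose indicator serves as both \<open>f\<close> and \<open>g\<close>.\<close>

lemma knapp_inequality:
  fixes E1 E2 :: "real set" and b0 :: "'a::euclidean_space"
    and T :: "('a \<Rightarrow> complex) \<Rightarrow> ('a \<Rightarrow> complex) \<Rightarrow> 'a \<Rightarrow> ennreal"
  assumes b0: "b0 \<in> Basis" and \<delta>: "0 < \<delta>" "\<delta> \<le> 1 / (16 * DIM('a))"
    and E: "E1 \<noteq> {}" "E1 \<subseteq> {1..2}" "E2 \<noteq> {}" "E2 \<subseteq> {1..2}"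
    and pqr: "0 < p" "0 < q" "0 < r" and C: "0 \<le> C"
    and T: "T = bilinear_spherical_maximal E1 E2"
    and bdd: "\<And>f g. in_Lp p f \<Longrightarrow> in_Lp q g \<Longrightarrow> Lp_norm r (T f g) \<le>
          ennreal C * Lp_norm p (\<lambda>x. ennreal (norm (f x))) * Lp_norm q (\<lambda>x. ennreal (norm (g x)))"
  defines "K \<equiv> 300 * real DIM('a)" and "S \<equiv> (2 * sqrt \<delta>) ^ (DIM('a) - 1)"
    and "V \<equiv> measure lborel (ball 0 1 :: ('a \<times> 'a) set)"
  shows "4 ^ (DIM('a) - 1) / 4 * \<delta> ^ DIM('a) / V
          * (covering_number (E_star E1 E2) \<delta> * (\<delta> / 2 * S)) powr enn2real (1 / r)
      \<le> C * (2 * K ^ DIM('a) * \<delta> * S) powr (enn2real (1 / p) + enn2real (1 / q))"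
proof -
  define P where "P = plate b0 (- (K * \<delta>)) (K * \<delta>) (K * sqrt \<delta>)"
  define m where "m = 2 * K ^ DIM('a) * \<delta> * S"
  define c where "c = 4 ^ (DIM('a) - 1) / 4 * \<delta> ^ DIM('a) / V"
  define N where "N = covering_number (E_star E1 E2) \<delta>"
  \<comment> \<open>Only the lower half of each grid cell is used: plates are closed, and full cells
    would share faces with their neighbours. Halving costs just a constant.\<close>
  define Q where "Q = (\<lambda>k::int. plate b0 (of_int k * \<delta>) (of_int k * \<delta> + \<delta> / 2) (sqrt \<delta>))"
  define I where "I = (\<lambda>e. \<lfloor>e / \<delta>\<rfloor>) ` E_star E1 E2"
  have K: "0 < K"
    unfolding K_def by simp
  have S: "0 < S"
    using \<delta> by (simp add: S_def)
  have V: "0 < V" "emeasure lborel (ball 0 1 :: ('a \<times> 'a) set) = ennreal V"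
    using content_ball_pos[of 1 "0 :: 'a \<times> 'a"] emeasure_lborel_ball_finite[of "0 :: 'a \<times> 'a" 1]
    by (auto simp: V_def emeasure_eq_ennreal_measure)
  have c: "0 < c" and m: "0 < m"
    using V K S \<delta> by (simp_all add: c_def m_def)
  have P: "P \<in> sets borel" "emeasure lborel P = ennreal m"
  proof -
    show "P \<in> sets borel" by (simp add: P_def b0 plate_borel)
    have "emeasure lborel P = ennreal ((K * \<delta> - - (K * \<delta>)) * (2 * (K * sqrt \<delta>)) ^ (DIM('a) - 1))"
      unfolding P_def using b0 K \<delta> by (intro emeasure_plate) (auto intro: order_trans[of _ 0])
    also have "(K * \<delta> - - (K * \<delta>)) * (2 * (K * sqrt \<delta>)) ^ (DIM('a) - 1)
        = 2 * (K * K ^ (DIM('a) - 1)) * \<delta> * S"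
      by (simp add: S_def power_mult_distrib)
    also have "K * K ^ (DIM('a) - 1) = K ^ DIM('a)"
      using DIM_positive[where 'a='a] by (metis power_eq_if not_gr_zero)
    finally show "emeasure lborel P = ennreal m" by (simp add: m_def)
  qed
  have E_star: "E_star E1 E2 \<subseteq> {0..2}" "E_star E1 E2 \<noteq> {}"
    using E E_star_subset by (auto simp: E_star_def)
  note cov = covering_number_le_grid[OF E_star \<delta>(1), folded I_def N_def]
  have T_ge: "ennreal c \<le> T (indicator P) (indicator P) x" if x: "x \<in> (\<Union>k\<in>I. Q k)" for x
  proof -
    obtain e where e: "e \<in> E_star E1 E2" and xe: "x \<in> Q \<lfloor>e / \<delta>\<rfloor>"
      using x by (auto simp: I_def)
    obtain t1 t2 where t: "t1 \<in> E1" "t2 \<in> E2" and et: "e = t1 * t2 / sqrt (t1\<^sup>2 + t2\<^sup>2)"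
      using e by (auto simp: E_star_def)
    have t': "t1 \<in> {1..2}" "t2 \<in> {1..2}"
      using t E by auto
    \<comment> \<open>Both \<open>x \<bullet> b0\<close> and \<open>e\<close> lie in the same grid
      cell of length \<delta>.\<close>
    have x1: "\<bar>x \<bullet> b0 - t1 * t2 / sqrt (t1\<^sup>2 + t2\<^sup>2)\<bar> \<le> \<delta>"
      using xe floor_grid[OF \<delta>(1), of e] \<delta>(1) unfolding et[symmetric] by (auto simp: Q_def plate_def abs_le_iff algebra_simps)
    have x2: "\<forall>b\<in>Basis - {b0}. \<bar>x \<bullet> b\<bar> \<le> sqrt \<delta>"
      using xe by (simp add: Q_def plate_def)
    let ?W = "{w :: 'a \<times> 'a. x - t1 *\<^sub>R fst w \<in> P \<and> x - t2 *\<^sub>R snd w \<in> P}"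
    have "ennreal c = emeasure lborel (knapp_cone b0 (t1 / t2) \<delta>) / ennreal V"
      using V \<delta> b0 by (simp add: emeasure_knapp_cone c_def divide_ennreal)
    also have "\<dots> \<le> emeasure sphere_measure ?W"
      unfolding V(2)[symmetric]
    proof (rule sphere_measure_ge_cone)
      have "(\<lambda>w::'a \<times> 'a. x - t1 *\<^sub>R fst w) \<in> borel_measurable borel"
           "(\<lambda>w::'a \<times> 'a. x - t2 *\<^sub>R snd w) \<in> borel_measurable borel"
        by (intro borel_measurable_continuous_onI continuous_intros)+
      from this[THEN measurable_sets, OF P(1)] show "?W \<in> sets borel"
        by (simp add: vimage_def Collect_conj_eq sets.Int)
      show "knapp_cone b0 (t1 / t2) \<delta> \<subseteq> ball 0 1"
        using knapp_cone_estimates(1)[OF b0 \<delta> t'] by auto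
      show "v /\<^sub>R norm v \<in> ?W" if "v \<in> knapp_cone b0 (t1 / t2) \<delta>" for v
        using knapp_cone_cap[OF b0 \<delta> t' _ x1 x2, of "fst v" "snd v"] that
        by (auto simp: P_def K_def)
    qed
    also have "\<dots> \<le> T (indicator P) (indicator P) x"
      unfolding T using P t by (intro bilinear_spherical_maximal_indicator_ge)
    finally show ?thesis .
  qed
  have "disjoint_family_on Q I"
    unfolding disjoint_family_on_def
  proof (intro ballI impI)
    fix j k :: int assume "j \<noteq> k"
    have "False" if x: "x \<in> Q j" "x \<in> Q k" and "j < k" for x j k
    proof -
      have "(of_int j + 1) * \<delta> \<le> of_int k * \<delta>"
        using \<open>j < k\<close> \<delta> by (intro mult_right_mono) linarith+
      then show False
        using x \<delta>(1) by (simp add: Q_def plate_def algebra_simps)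
    qed
    then show "Q j \<inter> Q k = {}"
      using \<open>j \<noteq> k\<close> by (metis disjoint_iff linorder_neqE)
  qed
  then have "emeasure lborel (\<Union>k\<in>I. Q k) = (\<Sum>k\<in>I. emeasure lborel (Q k))"
    using cov(1) b0 by (intro sum_emeasure[symmetric]) (auto simp: Q_def plate_borel)
  also have "\<dots> = (\<Sum>k\<in>I. ennreal (\<delta> / 2 * S))"
    using b0 \<delta> by (intro sum.cong) (auto simp: Q_def S_def emeasure_plate)
  also have "\<dots> = ennreal (card I * (\<delta> / 2 * S))"
    using \<delta> S by (simp add: ennreal_of_nat_eq_real_of_nat flip: ennreal_mult)
  finally have X: "emeasure lborel (\<Union>k\<in>I. Q k) = ennreal (card I * (\<delta> / 2 * S))" .
  have X': "(\<Union>k\<in>I. Q k) \<in> sets borel"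
    using cov(1) b0 by (auto simp: Q_def plate_borel)
  have cardI: "0 < card I" "N \<le> card I"
    using cov by auto
  have "ennreal (c * (card I * (\<delta> / 2 * S)) powr enn2real (1 / r)) \<le> Lp_norm r (T (indicator P) (indicator P))"
    using X' X T_ge cardI \<delta> S c pqr by (intro Lp_norm_ge) auto
  moreover have "c * (N * (\<delta> / 2 * S)) powr enn2real (1 / r) \<le> c * (card I * (\<delta> / 2 * S)) powr enn2real (1 / r)"
    using cardI c \<delta> S by (intro mult_left_mono powr_mono2 mult_right_mono) auto
  ultimately have "ennreal (c * (N * (\<delta> / 2 * S)) powr enn2real (1 / r))
      \<le> Lp_norm r (T (indicator P) (indicator P))"
    by (meson ennreal_leI order_trans)
  also have "\<dots> \<le> ennreal C * Lp_norm p (\<lambda>x. ennreal (norm (indicator P x :: complex)))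
      * Lp_norm q (\<lambda>x. ennreal (norm (indicator P x :: complex)))"
  proof -
    have "in_Lp s (indicator P :: 'a \<Rightarrow> complex)" if "0 < s" for s
      using Lp_norm_indicator_le[OF P m that] P(1)
      by (auto simp: in_Lp_def intro: le_less_trans)
    then show ?thesis
      using pqr by (intro bdd) auto
  qed
  also have "\<dots> \<le> ennreal C * ennreal (m powr enn2real (1 / p)) * ennreal (m powr enn2real (1 / q))"
    using P m pqr by (intro mult_mono Lp_norm_indicator_le) auto
  also have "\<dots> = ennreal (C * m powr (enn2real (1 / p) + enn2real (1 / q)))"
    using C by (simp add: ennreal_mult powr_add mult_ac)
  finally show ?thesis
    using C by (simp add: ennreal_le_iff c_def m_def N_def)
qed

section \<open>The limit as \<delta> tends to 0\<close>

theorem proposition7p8: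
  fixes E1 E2 :: "real set" and \<beta>1 \<beta>2 \<beta>s :: real and p q r :: ennreal
  assumes "CARD('d::finite) \<ge> 2"
    and "E1 \<noteq> {}" and "E1 \<subseteq> {1..2}"
    and "E2 \<noteq> {}" and "E2 \<subseteq> {1..2}"
    and "upper_minkowski_dim E1 = ereal \<beta>1"
    and "upper_minkowski_dim E2 = ereal \<beta>2"
    and "upper_minkowski_dim (E_star E1 E2) = ereal \<beta>s"
    and "1 \<le> p" and "1 \<le> q" and "0 < r"
    and "bounded_Lp_Lq_Lr p q r
           (bilinear_spherical_maximal E1 E2 ::
              (real^'d \<Rightarrow> complex) \<Rightarrow> (real^'d \<Rightarrow> complex) \<Rightarrow> real^'d \<Rightarrow> ennreal)"
  shows "enn2real (1 / p) + enn2real (1 / q)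
           \<le> 2 * real CARD('d) / (real CARD('d) + 1)
             + enn2real (1 / r) * (1 - 2 * \<beta>s / (real CARD('d) + 1))"
proof -
  define d where "d = CARD('d)"
  define K where "K = 300 * real d"
  define V where "V = measure lborel (ball 0 1 :: ((real^'d) \<times> (real^'d)) set)"
  define \<rho> where "\<rho> = enn2real (1 / r)"
  define \<sigma> where "\<sigma> = enn2real (1 / p) + enn2real (1 / q)"
  \<comment> \<open>A plate has one side of order \<delta> and d - 1 of order
    \<open>sqrt \<delta>\<close>, so its volume scales with exponent 1 + (d - 1)/2.\<close>
  define h where "h = (real d + 1) / 2"
  have d: "1 \<le> d" "DIM(real^'d) = d"
    using assms(1) by (auto simp: d_def)
  have V: "0 < V"
    by (simp add: V_def content_ball_pos)
  have pq: "0 < p" "0 < q"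
    using assms(9,10) by (auto intro: less_le_trans[of 0 1])
  obtain b0 :: "real^'d" where b0: "b0 \<in> Basis"
    using nonempty_Basis by blast
  obtain C0 :: real where C0: "\<And>f g :: real^'d \<Rightarrow> complex. in_Lp p f \<Longrightarrow> in_Lp q g \<Longrightarrow>
      Lp_norm r (bilinear_spherical_maximal E1 E2 f g) \<le>
      ennreal C0 * Lp_norm p (\<lambda>x. ennreal (norm (f x))) * Lp_norm q (\<lambda>x. ennreal (norm (g x)))"
    using assms(12) unfolding bounded_Lp_Lq_Lr_def by blast
  \<comment> \<open>\<open>ennreal\<close> sends negative reals to 0, so raising the constant to at
    least 0 leaves the bound unchanged.\<close>
  define C where "C = max 0 C0"
  have C: "0 \<le> C" "ennreal C0 = ennreal C"
    by (auto simp: C_def max_def ennreal_neg)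
  have S: "\<delta> * (2 * sqrt \<delta>) ^ (d - 1) = 2 ^ (d - 1) * \<delta> powr h" if "0 < \<delta>" for \<delta>
  proof -
    have "\<delta> * sqrt \<delta> ^ (d - 1) = \<delta> powr 1 * \<delta> powr (1 / 2 * real (d - 1))"
      using that by (simp add: powr_half_sqrt[symmetric] powr_power)
    also have "\<dots> = \<delta> powr h"
      unfolding powr_add[symmetric] using d(1) by (simp add: h_def field_simps of_nat_diff)
    finally show ?thesis
      by (simp add: power_mult_distrib)
  qed
  have "\<rho> * \<beta>s \<le> real d + h * \<rho> - h * \<sigma>"
  proof (rule Limsup_log_ratio_le)
    show "Limsup (at_right 0) (\<lambda>\<delta>. ereal (ln (real (covering_number (E_star E1 E2) \<delta>)) / ln (1 / \<delta>)))
        = ereal \<beta>s"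
      using assms(8) by (simp add: upper_minkowski_dim_def)
    show "0 < 4 ^ (d - 1) / 4 / V" "0 < (2 ^ (d - 1) / 2 :: real)" "0 < 2 * K ^ d * 2 ^ (d - 1)"
        "0 < 1 / (16 * real d)" "0 \<le> \<rho>"
      using V d by (auto simp: K_def \<rho>_def)
    fix \<delta> :: real assume \<delta>: "0 < \<delta>" "\<delta> < 1 / (16 * real d)"
    have "E_star E1 E2 \<noteq> {}"
      using assms(2,4) by (auto simp: E_star_def)
    then show "1 \<le> covering_number (E_star E1 E2) \<delta>"
      using covering_number_le_grid(2)[OF E_star_subset] assms(3,5) \<delta> by blast
    have "4 ^ (d - 1) / 4 * \<delta> ^ d / V
          * (covering_number (E_star E1 E2) \<delta> * (\<delta> / 2 * (2 * sqrt \<delta>) ^ (d - 1))) powr \<rho>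
      \<le> C * (2 * K ^ d * \<delta> * (2 * sqrt \<delta>) ^ (d - 1)) powr \<sigma>"
      using knapp_inequality[OF b0 \<delta>(1) _ assms(2-5) pq assms(11) C(1) refl C0[unfolded C(2)]] \<delta>(2)
      by (simp add: d_def \<rho>_def \<sigma>_def K_def V_def)
    also have "\<delta> / 2 * (2 * sqrt \<delta>) ^ (d - 1) = 2 ^ (d - 1) / 2 * \<delta> powr h"
      using S[OF \<delta>(1)] by simp
    also have "2 * K ^ d * \<delta> * (2 * sqrt \<delta>) ^ (d - 1) = 2 * K ^ d * 2 ^ (d - 1) * \<delta> powr h"
      using S[OF \<delta>(1)] by (simp only: mult.assoc)
    finally show "4 ^ (d - 1) / 4 / V * \<delta> powr d
        * (2 ^ (d - 1) / 2 * covering_number (E_star E1 E2) \<delta> * \<delta> powr h) powr \<rho>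
      \<le> C * (2 * K ^ d * 2 ^ (d - 1) * \<delta> powr h) powr \<sigma>"
      using \<delta>(1) by (simp add: powr_realpow mult_ac)
  qed
  \<comment> \<open>Doubling clears the denominator of \<open>h\<close>; dividing by d + 1 then
    gives the stated form.\<close>
  then have "\<sigma> * (real d + 1) \<le> 2 * real d + \<rho> * (real d + 1 - 2 * \<beta>s)"
    by (simp add: h_def field_simps)
  then have "\<sigma> \<le> (2 * real d + \<rho> * (real d + 1 - 2 * \<beta>s)) / (real d + 1)"
    by (simp add: pos_le_divide_eq)
  also have "\<dots> = 2 * real d / (real d + 1) + \<rho> * (1 - 2 * \<beta>s / (real d + 1))"
    by (simp add: add_divide_distrib diff_divide_distrib right_diff_distrib)
  finally show ?thesis
    by (simp add: \<rho>_def \<sigma>_def d_def)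
qed

end
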